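(* Let $N\ge 2$, let $\mathcal H$ be an $N$-dimensional complex Hilbert space with fixed orthonormal basis $\{|\mu\rangle\}_{\mu=0}^{N-1}$, let $\epsilon\in[0,1]$, $\gamma\in\mathbb C$, $\alpha_{\mu\nu}\in\mathbb C$, and suppose that the map $$\Lambda_{\epsilon,\gamma}(\rho)=\sum_{\mu=0}^{N-1}\rho_{\mu\mu}\Big[(1-\epsilon)|\mu\rangle\langle\mu|+\sum_{\nu\ne\mu}\frac{\epsilon}{N-1}|\nu\rangle\langle\nu|\Big]+\sum_{\mu<\nu}\Big\{\rho_{\mu\nu}\big[(1+\alpha_{\mu\nu})|\mu\rangle\langle\nu|+\gamma|\nu\rangle\langle\mu|\big]+\mathrm{h.c.}\Big\}$$ is completely positive and trace-preserving (i.e. is a faulty $(\epsilon,\gamma)$-aQNN). Then initial entanglement with an ancilla cannot be used to reduce the depth of the network, in the following sense: for every density operator $\rho$ on $\mathcal H$, every ancillary Hilbert space $\mathcal A$, every pure state $\psi=|\psi\rangle\langle\psi|$ on $\mathcal H\otimes\mathcal A$ with $\mathrm{Tr}_{\mathcal A}(\psi)=\rho$, and every coherence measure $C$, it is not the case that $$C(\Lambda_{\epsilon,\gamma}(\rho))>C\big(\mathrm{Tr}_{\mathcal A}\{(\Lambda_{\epsilon,\gamma}\otimes\mathrm{id})(\psi)\}\big).$$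
   Context: $\rho_{\mu\nu}=\langle\mu|\rho|\nu\rangle$, h.c. denotes the Hermitian conjugate for Hermitian $\rho$ (the map is then extended linearly), $\mathrm{id}$ is the identity map on $\mathcal B(\mathcal A)$, and $\mathrm{Tr}_{\mathcal A}$ is the partial trace over $\mathcal A$. A coherence measure is a functional $C:\mathcal B(\mathcal H)\to\mathbb R_{\ge0}$ with $C(\delta)=0$ for every incoherent state $\delta$ (density operator diagonal in the fixed basis) and $C(\rho)\ge C(\mathcal E(\rho))$ for every non-coherence-generating operation $\mathcal E$ (a channel mapping incoherent states to incoherent states). The depth of the network is the minimum number of applications of the map needed for the state's coherence to fall to a prescribed tolerance; using the entangled input would help reduce the depth precisely if it yielded an output with strictly smaller coherence than $\Lambda_{\epsilon,\gamma}(\rho)$. *)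

theory Defs
  imports "HOL-Analysis.Analysis" "HOL-Library.Nonpos_Ints"
begin

text \<open>
  The Hilbert space \<open>H\<close> is \<^typ>\<open>complex^'n\<close> with its standard basis, indexed by a finite linearly
  ordered type of cardinality \<open>N\<close>; operators on \<open>H\<close> are given by their matrices in this basis.
\<close>

type_synonym 'n operator = "complex^'n^'n"

definition scale_op :: "complex \<Rightarrow> ('n::finite) operator \<Rightarrow> 'n operator" (infixr "*\<^sub>M" 75)
  where "c *\<^sub>M A = map_matrix ((*) c) A"

definition adj :: "('n::finite) operator \<Rightarrow> 'n operator"
  where "adj A = map_matrix cnj (transpose A)"

definition ket_bra :: "'n::finite \<Rightarrow> 'n \<Rightarrow> 'n operator"
  where "ket_bra \<mu> \<nu> = (\<chi> i j. if i = \<mu> \<and> j = \<nu> then 1 else 0)"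

definition cinner :: "complex^'n \<Rightarrow> complex^('n::finite) \<Rightarrow> complex"
  where "cinner u v = (\<Sum>\<mu>\<in>UNIV. cnj (u $ \<mu>) * v $ \<mu>)"

text \<open>Over the complex numbers, positivity of the quadratic form already implies Hermiticity.\<close>

definition psd :: "('n::finite) operator \<Rightarrow> bool"
  where "psd A \<longleftrightarrow> (\<forall>v. cinner v (A *v v) \<in> \<real>\<^sub>\<ge>\<^sub>0)"

definition density_operator :: "('n::finite) operator \<Rightarrow> bool"
  where "density_operator \<rho> \<longleftrightarrow> psd \<rho> \<and> trace \<rho> = 1"

definition incoherent :: "('n::finite) operator \<Rightarrow> bool"
  where "incoherent \<delta> \<longleftrightarrow> density_operator \<delta> \<and> (\<forall>\<mu> \<nu>. \<mu> \<noteq> \<nu> \<longrightarrow> \<delta> $ \<mu> $ \<nu> = 0)"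

text \<open>
  An ancillary Hilbert space is \<open>\<ell>\<^sup>2('a)\<close> for an arbitrary, possibly infinite, type \<^typ>\<open>'a\<close> indexing an
  orthonormal basis; every nonzero Hilbert space is of this form up to unitary equivalence.
  A vector \<open>\<psi> = (\<Sum>i. \<psi>\<^sub>i \<otimes> |i\<rangle>)\<close> of \<open>H \<otimes> A\<close> is the family \<open>\<psi>\<close> of its components in \<open>H\<close>. An operator \<open>X\<close> on
  \<open>H \<otimes> A\<close> is the family of its blocks \<open>X i j = (id \<otimes> \<langle>i|) X (id \<otimes> |j\<rangle>)\<close>, which are operators on \<open>H\<close>.
\<close>

type_synonym ('n, 'a) block_operator = "'a \<Rightarrow> 'a \<Rightarrow> 'n operator"

definition unit_vector :: "('a \<Rightarrow> complex^('n::finite)) \<Rightarrow> bool"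
  where "unit_vector \<psi> \<longleftrightarrow> ((\<lambda>i. (norm (\<psi> i))\<^sup>2) has_sum 1) UNIV"

definition pure_state :: "('a \<Rightarrow> complex^('n::finite)) \<Rightarrow> ('n, 'a) block_operator"
  where "pure_state \<psi> = (\<lambda>i j. \<chi> \<mu> \<nu>. \<psi> i $ \<mu> * cnj (\<psi> j $ \<nu>))"

definition tensor_op :: "('n::finite) operator \<Rightarrow> ('a \<Rightarrow> 'a \<Rightarrow> complex) \<Rightarrow> ('n, 'a) block_operator"
  where "tensor_op A Y = (\<lambda>i j. Y i j *\<^sub>M A)"

definition tensor_id ::
    "(('n::finite) operator \<Rightarrow> 'n operator) \<Rightarrow> ('n, 'a) block_operator \<Rightarrow> ('n, 'a) block_operator"
  where "tensor_id \<Phi> X = (\<lambda>i j. \<Phi> (X i j))"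

definition partial_trace :: "('n::finite, 'a) block_operator \<Rightarrow> 'n operator"
  where "partial_trace X = (\<Sum>\<^sub>\<infinity>i. X i i)"

definition linear_op_map :: "(('n::finite) operator \<Rightarrow> 'n operator) \<Rightarrow> bool"
  where "linear_op_map \<Phi> \<longleftrightarrow> Vector_Spaces.linear (*\<^sub>M) (*\<^sub>M) \<Phi>"

text \<open>Positivity of a block operator on \<open>H \<otimes> \<complex>\<^sup>d\<close>; only the blocks with indices below \<open>d\<close> matter.\<close>

definition psd_block :: "nat \<Rightarrow> ('n::finite, nat) block_operator \<Rightarrow> bool"
  where "psd_block d X \<longleftrightarrow> (\<forall>v. (\<Sum>i<d. \<Sum>j<d. cinner (v i) (X i j *v v j)) \<in> \<real>\<^sub>\<ge>\<^sub>0)"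

definition completely_positive :: "(('n::finite) operator \<Rightarrow> 'n operator) \<Rightarrow> bool"
  where "completely_positive \<Phi> \<longleftrightarrow> (\<forall>d X. psd_block d X \<longrightarrow> psd_block d (tensor_id \<Phi> X))"

definition trace_preserving :: "(('n::finite) operator \<Rightarrow> 'n operator) \<Rightarrow> bool"
  where "trace_preserving \<Phi> \<longleftrightarrow> (\<forall>A. trace (\<Phi> A) = trace A)"

definition channel :: "(('n::finite) operator \<Rightarrow> 'n operator) \<Rightarrow> bool"
  where "channel \<Phi> \<longleftrightarrow> linear_op_map \<Phi> \<and> completely_positive \<Phi> \<and> trace_preserving \<Phi>"

definition non_coherence_generating :: "(('n::finite) operator \<Rightarrow> 'n operator) \<Rightarrow> bool"
  where "non_coherence_generating \<Phi> \<longleftrightarrow> channel \<Phi> \<and> (\<forall>\<delta>. incoherent \<delta> \<longrightarrow> incoherent (\<Phi> \<delta>))"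

definition coherence_measure :: "(('n::finite) operator \<Rightarrow> real) \<Rightarrow> bool"
  where "coherence_measure C \<longleftrightarrow>
    (\<forall>A. 0 \<le> C A) \<and>
    (\<forall>\<delta>. incoherent \<delta> \<longrightarrow> C \<delta> = 0) \<and>
    (\<forall>\<Phi> \<rho>. non_coherence_generating \<Phi> \<longrightarrow> density_operator \<rho> \<longrightarrow> C \<rho> \<ge> C (\<Phi> \<rho>))"

definition aqnn_off ::
    "complex \<Rightarrow> ('n \<Rightarrow> 'n \<Rightarrow> complex) \<Rightarrow> 'n \<Rightarrow> 'n \<Rightarrow> ('n::finite) operator"
  where "aqnn_off \<gamma> \<alpha> \<mu> \<nu> = (1 + \<alpha> \<mu> \<nu>) *\<^sub>M ket_bra \<mu> \<nu> + \<gamma> *\<^sub>M ket_bra \<nu> \<mu>"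

text \<open>
  For Hermitian \<open>\<rho>\<close> the Hermitian conjugate of \<open>\<rho>\<^sub>\<mu>\<^sub>\<nu> B\<close> is \<open>cnj \<rho>\<^sub>\<mu>\<^sub>\<nu> B\<^sup>\<dagger> = \<rho>\<^sub>\<nu>\<^sub>\<mu> B\<^sup>\<dagger>\<close>; the last expression is
  linear in \<open>\<rho>\<close> and thus gives the linear extension to all operators.
\<close>

definition aqnn ::
    "real \<Rightarrow> complex \<Rightarrow> ('n \<Rightarrow> 'n \<Rightarrow> complex) \<Rightarrow> ('n::{finite,linorder}) operator \<Rightarrow> 'n operator"
  where "aqnn \<epsilon> \<gamma> \<alpha> \<rho> =
    (\<Sum>\<mu>\<in>UNIV. \<rho> $ \<mu> $ \<mu> *\<^sub>M
       (complex_of_real (1 - \<epsilon>) *\<^sub>M ket_bra \<mu> \<mu>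
        + (\<Sum>\<nu>\<in>UNIV - {\<mu>}. complex_of_real (\<epsilon> / (real CARD('n) - 1)) *\<^sub>M ket_bra \<nu> \<nu>)))
    + (\<Sum>\<mu>\<in>UNIV. \<Sum>\<nu>\<in>{\<mu><..}.
         \<rho> $ \<mu> $ \<nu> *\<^sub>M aqnn_off \<gamma> \<alpha> \<mu> \<nu> + \<rho> $ \<nu> $ \<mu> *\<^sub>M adj (aqnn_off \<gamma> \<alpha> \<mu> \<nu>))"

lemma scale_op_nth [simp]: "(c *\<^sub>M A) $ i $ j = c * A $ i $ j"
  by (simp add: scale_op_def map_matrix_def)

lemma vector_space_scale_op: "vector_space ((*\<^sub>M) :: complex \<Rightarrow> ('n::finite) operator \<Rightarrow> 'n operator)"
  by standard (simp_all add: vec_eq_iff algebra_simps)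

lemma adj_nth [simp]: "adj A $ i $ j = cnj (A $ j $ i)"
  by (simp add: adj_def map_matrix_def transpose_def)

lemma aqnn_hermitian:
  fixes \<rho> :: "('n::{finite,linorder}) operator"
  assumes "adj \<rho> = \<rho>"
  shows "aqnn \<epsilon> \<gamma> \<alpha> \<rho> =
    (\<Sum>\<mu>\<in>UNIV. \<rho> $ \<mu> $ \<mu> *\<^sub>M
       (complex_of_real (1 - \<epsilon>) *\<^sub>M ket_bra \<mu> \<mu>
        + (\<Sum>\<nu>\<in>UNIV - {\<mu>}. complex_of_real (\<epsilon> / (real CARD('n) - 1)) *\<^sub>M ket_bra \<nu> \<nu>)))
    + (\<Sum>\<mu>\<in>UNIV. \<Sum>\<nu>\<in>{\<mu><..}.
         \<rho> $ \<mu> $ \<nu> *\<^sub>M aqnn_off \<gamma> \<alpha> \<mu> \<nu> + adj (\<rho> $ \<mu> $ \<nu> *\<^sub>M aqnn_off \<gamma> \<alpha> \<mu> \<nu>))"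
proof -
  have "cnj (\<rho> $ \<mu> $ \<nu>) = \<rho> $ \<nu> $ \<mu>" for \<mu> \<nu>
    by (metis adj_nth assms)
  then have "adj (\<rho> $ \<mu> $ \<nu> *\<^sub>M B) = \<rho> $ \<nu> $ \<mu> *\<^sub>M adj B" for \<mu> \<nu> and B :: "'n operator"
    by (simp add: vec_eq_iff)
  then show ?thesis
    by (simp add: aqnn_def)
qed

lemma linear_op_map_iff:
  "linear_op_map \<Phi> \<longleftrightarrow>
    (\<forall>A B. \<Phi> (A + B) = \<Phi> A + \<Phi> B) \<and> (\<forall>c A. \<Phi> (c *\<^sub>M A) = c *\<^sub>M \<Phi> A)"
  by (auto simp: linear_op_map_def Vector_Spaces.linear_iff vector_space_scale_op)

lemma linear_aqnn: "linear_op_map (aqnn \<epsilon> \<gamma> \<alpha>)"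
  by (simp add: linear_op_map_iff aqnn_def vec_eq_iff sum.distrib sum_distrib_left
      distrib_right distrib_left mult.assoc add_divide_distrib)

lemma tensor_id_tensor_op:
  "linear_op_map \<Phi> \<Longrightarrow> tensor_id \<Phi> (tensor_op A Y) = tensor_op (\<Phi> A) Y"
  by (simp add: linear_op_map_iff tensor_id_def tensor_op_def)

end

theory Submission imports Defs begin

text \<open>A linear map acting on H alone commutes with the partial trace over the ancilla. The
  reduced output for the purification \<open>\<psi>\<close> is therefore exactly the output for
  \<open>\<rho>\<close>: \<open>C\<close> takes the same value on both, so neither is strictly
  larger. The one analytic point is that an infinite ancilla makes the partial trace an infinite
  sum; \<open>partial_trace_tensor_id\<close> handles it by continuity.\<close>

lemma linear_op_map_bounded_linear:
  assumes "linear_op_map \<Phi>"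
  shows "bounded_linear \<Phi>"
proof -
  \<comment> \<open>Real scalars act as complex ones, so complex linearity yields the real linearity
    that gives boundedness in finite dimension.\<close>
  have scale: "r *\<^sub>R A = complex_of_real r *\<^sub>M A" for r and A :: "('n::finite) operator"
    by (simp add: vec_eq_iff complex_eq_iff)
  have "linear \<Phi>"
    using assms by (intro linearI) (simp_all add: linear_op_map_iff scale)
  then show ?thesis
    by (simp add: linear_conv_bounded_linear)
qed

text \<open>\<open>\<Phi>\<close> acts block by block, and being continuous it passes through the
  sum of the diagonal blocks. Summability excludes divergent blocks whose images under
  \<open>\<Phi>\<close> converge to a nonzero sum: there the right side would be
  \<open>\<Phi> 0 = 0\<close>.\<close>

lemma partial_trace_tensor_id:
  assumes "linear_op_map \<Phi>" and "(\<lambda>i. X i i) summable_on UNIV"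
  shows "partial_trace (tensor_id \<Phi> X) = \<Phi> (partial_trace X)"
  unfolding partial_trace_def tensor_id_def
  using has_sum_bounded_linear[OF linear_op_map_bounded_linear[OF assms(1)] has_sum_infsum[OF assms(2)]]
  by (rule infsumI)

theorem proposition12:
  fixes \<epsilon> :: real and \<gamma> :: complex and \<alpha> :: "'n::{finite,linorder} \<Rightarrow> 'n \<Rightarrow> complex"
    and \<rho> :: "'n operator" and \<psi> :: "'a \<Rightarrow> complex^('n::{finite,linorder})" and C :: "'n operator \<Rightarrow> real"
  assumes "CARD('n) \<ge> 2"
    and "0 \<le> \<epsilon>" and "\<epsilon> \<le> 1"
    and "channel (aqnn \<epsilon> \<gamma> \<alpha>)"
    and "density_operator \<rho>"
    and "unit_vector \<psi>"
    and "partial_trace (pure_state \<psi>) = \<rho>"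
    and "coherence_measure C"
  shows "\<not> C (aqnn \<epsilon> \<gamma> \<alpha> \<rho>) > C (partial_trace (tensor_id (aqnn \<epsilon> \<gamma> \<alpha>) (pure_state \<psi>)))"
proof -
  \<comment> \<open>a divergent \<open>infsum\<close> is \<open>0\<close>, which does not have trace \<open>1\<close>\<close>
  have "(\<lambda>i. pure_state \<psi> i i) summable_on UNIV"
  proof (rule ccontr)
    assume "\<not> ?thesis"
    then have "\<rho> = 0"
      using assms(7) by (simp add: partial_trace_def infsum_not_exists)
    then show False
      using assms(5) by (simp add: density_operator_def trace_def)
  qed
  then have "partial_trace (tensor_id (aqnn \<epsilon> \<gamma> \<alpha>) (pure_state \<psi>)) = aqnn \<epsilon> \<gamma> \<alpha> \<rho>"
    using partial_trace_tensor_id[OF linear_aqnn] assms(7) by metis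
  then show ?thesis
    by simp
qed

end
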